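(* Let $M\ge2$ be an integer and let $\tau_1,\dots,\tau_k$ be sporadic tasks indexed in deadline-monotonic order, $D_1\le D_2\le\dots\le D_k$. The linear-time test analytically dominates the Baruah–Fisher load-based test; that is, if $$2\,\mathrm{load}(k)+(\lceil\mu_k\rceil-1)\,\delta_{\max}(k)\le\mu_k,\qquad \mu_k=M-(M-1)\delta_{\max}(k),$$ then $$\delta_k+\sum_{i=1}^{k-1}\left(\frac{C_i-C_iU_i}{D_k}+U_i\right)\le M-(M-1)U_{\delta,k}^{\max}.$$
   Context: Each task $\tau_i$ has parameters $C_i,T_i,D_i>0$ (worst-case execution time, minimum inter-arrival time, relative deadline), with $U_i=C_i/T_i\le1$ and $C_i\le D_i$; no relation between $D_i$ and $T_i$ is assumed. Notation. $\delta_i=C_i/\min\{D_i,T_i\}$; $\delta_{\max}(k)=\max_{1\le i\le k}\delta_i$; $U_{\delta,k}^{\max}=\max\{\max_{1\le i\le k-1}U_i,\ \delta_k\}$; $\mathrm{dbf}(\tau_i,t)=\max\{0,\ (\lfloor\frac{t-D_i}{T_i}\rfloor+1)C_i\}$ for $t\ge0$; $\mathrm{load}(k)=\sup_{t>0}\frac{1}{t}\sum_{i=1}^k\mathrm{dbf}(\tau_i,t)$. A test $\mathcal{B}_1$ analytically dominates a test $\mathcal{B}_2$ if whenever the condition of $\mathcal{B}_2$ holds for $\tau_k$, so does the condition of $\mathcal{B}_1$. *)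

theory Defs
  imports Complex_Main
begin

record task =
  wcet :: real
  period :: real
  deadline :: real

definition utilization :: "task \<Rightarrow> real" where
  "utilization x = wcet x / period x"

definition sporadic_task :: "task \<Rightarrow> bool" where
  "sporadic_task x \<longleftrightarrow>
     0 < wcet x \<and> 0 < period x \<and> 0 < deadline x \<and>
     utilization x \<le> 1 \<and> wcet x \<le> deadline x"

definition density :: "task \<Rightarrow> real" where
  "density x = wcet x / min (deadline x) (period x)"

definition dbf :: "task \<Rightarrow> real \<Rightarrow> real" where
  "dbf x t = max 0 ((of_int \<lfloor>(t - deadline x) / period x\<rfloor> + 1) * wcet x)"

text \<open>Task systems are sequences of tasks, of which the indices from 1 to \<open>k\<close> are used.\<close>

definition delta_max :: "(nat \<Rightarrow> task) \<Rightarrow> nat \<Rightarrow> real" where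
  "delta_max \<tau> k = Max ((\<lambda>i. density (\<tau> i)) ` {1..k})"

text \<open>For \<open>k = 1\<close> there are no utilizations to take the maximum over, and the value is the
  density of the single task.\<close>

definition U_delta_max :: "(nat \<Rightarrow> task) \<Rightarrow> nat \<Rightarrow> real" where
  "U_delta_max \<tau> k = Max (insert (density (\<tau> k)) ((\<lambda>i. utilization (\<tau> i)) ` {1..<k}))"

text \<open>The supremum is taken in the reals; \<open>bdd_above_load\<close> below shows that it is a
  genuine one for sporadic tasks.\<close>

definition load :: "(nat \<Rightarrow> task) \<Rightarrow> nat \<Rightarrow> real" where
  "load \<tau> k = (SUP t\<in>{0<..}. (1 / t) * (\<Sum>i=1..k. dbf (\<tau> i) t))"

definition mu :: "nat \<Rightarrow> (nat \<Rightarrow> task) \<Rightarrow> nat \<Rightarrow> real" where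
  "mu M \<tau> k = real M - (real M - 1) * delta_max \<tau> k"

lemma dbf_le:
  assumes "sporadic_task x" "0 < t"
  shows "dbf x t \<le> t * (utilization x + wcet x / deadline x)"
proof -
  have pos: "0 < wcet x" "0 < period x" "0 < deadline x"
    using assms(1) by (auto simp: sporadic_task_def)
  have rhs: "0 \<le> t * (utilization x + wcet x / deadline x)"
    using pos assms(2) by (simp add: utilization_def)
  show ?thesis
  proof (cases "t < deadline x")
    case True
    then have "(t - deadline x) / period x < 0"
      using pos by (simp add: divide_neg_pos)
    then have "\<lfloor>(t - deadline x) / period x\<rfloor> + 1 \<le> 0"
      by linarith
    then have "(of_int \<lfloor>(t - deadline x) / period x\<rfloor> + 1 :: real) \<le> 0"
      by linarith
    then have "(of_int \<lfloor>(t - deadline x) / period x\<rfloor> + 1) * wcet x \<le> 0"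
      using pos by (simp add: mult_le_0_iff)
    with rhs show ?thesis by (simp add: dbf_def)
  next
    case False
    have "(t - deadline x) / period x \<le> t / period x"
      using pos by (simp add: divide_right_mono)
    moreover have "1 \<le> t / deadline x"
      using False pos by simp
    ultimately have "of_int \<lfloor>(t - deadline x) / period x\<rfloor> + 1 \<le> t / period x + t / deadline x"
      by linarith
    then have "(of_int \<lfloor>(t - deadline x) / period x\<rfloor> + 1) * wcet x
        \<le> (t / period x + t / deadline x) * wcet x"
      using pos by (simp add: mult_right_mono)
    also have "\<dots> = t * (utilization x + wcet x / deadline x)"
      by (simp add: utilization_def algebra_simps)
    finally show ?thesis using rhs by (simp add: dbf_def)
  qed
qed

lemma bdd_above_load:
  assumes "\<And>i. i \<in> {1..k} \<Longrightarrow> sporadic_task (\<tau> i)"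
  shows "bdd_above ((\<lambda>t. (1 / t) * (\<Sum>i=1..k. dbf (\<tau> i) t)) ` {0<..})"
proof (rule bdd_aboveI2)
  fix t :: real
  assume "t \<in> {0<..}"
  then have t: "0 < t" by simp
  have "(\<Sum>i=1..k. dbf (\<tau> i) t)
      \<le> (\<Sum>i=1..k. t * (utilization (\<tau> i) + wcet (\<tau> i) / deadline (\<tau> i)))"
    by (intro sum_mono dbf_le assms t)
  also have "\<dots> = t * (\<Sum>i=1..k. utilization (\<tau> i) + wcet (\<tau> i) / deadline (\<tau> i))"
    by (simp add: sum_distrib_left)
  finally show "(1 / t) * (\<Sum>i=1..k. dbf (\<tau> i) t)
      \<le> (\<Sum>i=1..k. utilization (\<tau> i) + wcet (\<tau> i) / deadline (\<tau> i))"
    using t by (simp add: field_simps)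
qed

end

(* Evaluating the demand at t = D_k, where every task has released a job with deadline at most D_k,
   bounds the sum of the C_i / D_k by the load; letting t tend to infinity bounds the total
   utilization by the load. As the density of task k is the larger of C_k / D_k and U_k, the
   left-hand side is at most twice the load. *)

theory Submission
  imports Defs
begin

lemma utilization_nonneg: "sporadic_task x \<Longrightarrow> 0 \<le> utilization x"
  by (simp add: sporadic_task_def utilization_def)

text \<open>Dividing a positive number by the smaller of two positive numbers gives the larger
  quotient. In this form, density is compared directly with utilization and with 1.\<close>

lemma density_eq_max:
  assumes "sporadic_task x"
  shows "density x = max (wcet x / deadline x) (utilization x)"
  using assms
  by (auto simp: sporadic_task_def density_def utilization_def min_def max_def field_simps)

lemma density_le_1: "sporadic_task x \<Longrightarrow> density x \<le> 1"
  by (simp add: density_eq_max) (simp add: sporadic_task_def)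

lemma density_nonneg: "sporadic_task x \<Longrightarrow> 0 \<le> density x"
  by (simp add: density_eq_max utilization_nonneg le_max_iff_disj)

text \<open>Once \<open>t\<close> reaches the deadline the floor is nonnegative, so at least one job
  is counted.\<close>

lemma wcet_le_dbf:
  assumes "sporadic_task x" "deadline x \<le> t"
  shows "wcet x \<le> dbf x t"
proof -
  have pos: "0 < wcet x" "0 < period x"
    using assms(1) by (auto simp: sporadic_task_def)
  have "0 \<le> \<lfloor>(t - deadline x) / period x\<rfloor>"
    using pos assms(2) by simp
  then have "1 * wcet x \<le> (of_int \<lfloor>(t - deadline x) / period x\<rfloor> + 1) * wcet x"
    using pos by (intro mult_right_mono) auto
  then show ?thesis
    by (simp add: dbf_def)
qed

text \<open>Since the floor of x plus 1 is at least x, the demand staircase lies above the line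
  whose slope is the utilization and whose zero is at the deadline.\<close>

lemma dbf_ge_linear:
  assumes "sporadic_task x"
  shows "utilization x * (t - deadline x) \<le> dbf x t"
proof -
  have "(t - deadline x) / period x * wcet x
      \<le> (of_int \<lfloor>(t - deadline x) / period x\<rfloor> + 1) * wcet x"
    using assms by (intro mult_right_mono) (auto simp: sporadic_task_def)
  then show ?thesis
    by (simp add: dbf_def utilization_def mult.commute)
qed

lemma sum_dbf_le_load:
  assumes "\<And>i. i \<in> {1..k} \<Longrightarrow> sporadic_task (\<tau> i)" "0 < t"
  shows "(\<Sum>i=1..k. dbf (\<tau> i) t) \<le> t * load \<tau> k"
proof -
  have "(1 / t) * (\<Sum>i=1..k. dbf (\<tau> i) t) \<le> load \<tau> k"
    unfolding load_def using assms by (intro cSUP_upper bdd_above_load) auto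
  then show ?thesis
    using assms(2) by (simp add: field_simps)
qed

text \<open>Stands in for dividing by \<open>t\<close> and letting \<open>t\<close> tend to
  infinity: a constant offset cannot compensate for a larger slope.\<close>

lemma le_if_linear_le:
  fixes a b c :: real
  assumes "\<And>t. 0 < t \<Longrightarrow> a * t - c \<le> b * t"
  shows "a \<le> b"
proof (rule ccontr)
  assume "\<not> a \<le> b"
  then have "0 < a - b" by simp
  \<comment> \<open>Chosen so that \<open>(a - b) * t\<close> exceeds \<open>c\<close>, whereas the
    assumption bounds it by \<open>c\<close>.\<close>
  define t where "t = (\<bar>c\<bar> + 1) / (a - b)"
  have "0 < t" and "(a - b) * t = \<bar>c\<bar> + 1"
    using \<open>0 < a - b\<close> by (simp_all add: t_def)
  with assms[of t] show False
    by (simp add: left_diff_distrib)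
qed

text \<open>Adding the linear lower bounds of all tasks gives a line whose slope is the total
  utilization and whose offset does not depend on \<open>t\<close>. It stays below
  \<open>load \<tau> k * t\<close>, so the slopes compare.\<close>

lemma sum_utilization_le_load:
  assumes "\<And>i. i \<in> {1..k} \<Longrightarrow> sporadic_task (\<tau> i)"
  shows "(\<Sum>i=1..k. utilization (\<tau> i)) \<le> load \<tau> k"
proof (rule le_if_linear_le)
  fix t :: real
  assume "0 < t"
  have "(\<Sum>i=1..k. utilization (\<tau> i)) * t - (\<Sum>i=1..k. utilization (\<tau> i) * deadline (\<tau> i))
      = (\<Sum>i=1..k. utilization (\<tau> i) * (t - deadline (\<tau> i)))"
    by (simp add: sum_distrib_right right_diff_distrib sum_subtractf)
  also have "\<dots> \<le> (\<Sum>i=1..k. dbf (\<tau> i) t)"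
    by (intro sum_mono dbf_ge_linear assms)
  also have "\<dots> \<le> load \<tau> k * t"
    using sum_dbf_le_load[OF assms \<open>0 < t\<close>] by (simp add: mult.commute)
  finally show "(\<Sum>i=1..k. utilization (\<tau> i)) * t
      - (\<Sum>i=1..k. utilization (\<tau> i) * deadline (\<tau> i)) \<le> load \<tau> k * t" .
qed

text \<open>Each task contributes at least one job to the demand at \<open>t\<close>. The theorem
  uses this with \<open>t\<close> the deadline of task \<open>k\<close>, the largest one by the
  deadline-monotonic order.\<close>

lemma sum_wcet_le_load:
  assumes "\<And>i. i \<in> {1..k} \<Longrightarrow> sporadic_task (\<tau> i)"
    and "\<And>i. i \<in> {1..k} \<Longrightarrow> deadline (\<tau> i) \<le> t" and "0 < t"
  shows "(\<Sum>i=1..k. wcet (\<tau> i) / t) \<le> load \<tau> k"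
proof -
  have "(\<Sum>i=1..k. wcet (\<tau> i)) \<le> (\<Sum>i=1..k. dbf (\<tau> i) t)"
    by (intro sum_mono wcet_le_dbf assms)
  also have "\<dots> \<le> t * load \<tau> k"
    by (rule sum_dbf_le_load[OF assms(1,3)])
  finally show ?thesis
    using assms(3) by (simp add: sum_divide_distrib[symmetric] field_simps)
qed

lemma delta_max_bounds:
  assumes "\<And>i. i \<in> {1..k} \<Longrightarrow> sporadic_task (\<tau> i)" "1 \<le> k"
  shows "0 \<le> delta_max \<tau> k" "delta_max \<tau> k \<le> 1"
proof -
  have "density (\<tau> k) \<le> delta_max \<tau> k"
    unfolding delta_max_def using assms(2) by (intro Max_ge) auto
  then show "0 \<le> delta_max \<tau> k"
    using density_nonneg[of "\<tau> k"] assms by force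
  show "delta_max \<tau> k \<le> 1"
    unfolding delta_max_def using assms by (subst Max_le_iff) (auto intro: density_le_1)
qed

text \<open>Every utilization is at most the density of the same task, so each candidate for the
  left maximum is dominated by a density of one of the first \<open>k\<close> tasks.\<close>

lemma U_delta_max_le_delta_max:
  assumes "\<And>i. i \<in> {1..k} \<Longrightarrow> sporadic_task (\<tau> i)" "1 \<le> k"
  shows "U_delta_max \<tau> k \<le> delta_max \<tau> k"
proof -
  have dens: "density (\<tau> i) \<le> delta_max \<tau> k" if "i \<in> {1..k}" for i
    unfolding delta_max_def using that by (intro Max_ge) auto
  have "utilization (\<tau> i) \<le> delta_max \<tau> k" if "i \<in> {1..<k}" for i
    using dens[of i] density_eq_max[OF assms(1), of i] that by auto
  with dens[of k] assms(2) show ?thesis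
    unfolding U_delta_max_def by (subst Max_le_iff) auto
qed

theorem corollary5p1:
  fixes M k :: nat and \<tau> :: "nat \<Rightarrow> task"
  assumes "M \<ge> 2" and "k \<ge> 1"
    and "\<And>i. i \<in> {1..k} \<Longrightarrow> sporadic_task (\<tau> i)"
    and "\<And>i j. 1 \<le> i \<Longrightarrow> i \<le> j \<Longrightarrow> j \<le> k \<Longrightarrow> deadline (\<tau> i) \<le> deadline (\<tau> j)"
    and "2 * load \<tau> k + (of_int \<lceil>mu M \<tau> k\<rceil> - 1) * delta_max \<tau> k \<le> mu M \<tau> k"
  shows "density (\<tau> k)
      + (\<Sum>i=1..<k. (wcet (\<tau> i) - wcet (\<tau> i) * utilization (\<tau> i)) / deadline (\<tau> k)
                    + utilization (\<tau> i))
    \<le> real M - (real M - 1) * U_delta_max \<tau> k"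
proof -
  let ?D = "deadline (\<tau> k)" and ?\<delta> = "delta_max \<tau> k"
  note spor = assms(3)
  have spk: "sporadic_task (\<tau> k)"
    using spor assms(2) by simp
  then have D: "0 < ?D"
    by (simp add: sporadic_task_def)
  have split: "sum f {1..k} = sum f {1..<k} + f k" for f :: "nat \<Rightarrow> real"
    using assms(2) by (simp add: sum.last_plus add.commute)
  have "(\<Sum>i=1..<k. (wcet (\<tau> i) - wcet (\<tau> i) * utilization (\<tau> i)) / ?D + utilization (\<tau> i))
      \<le> (\<Sum>i=1..<k. wcet (\<tau> i) / ?D + utilization (\<tau> i))"
  proof (intro sum_mono add_right_mono divide_right_mono)
    fix i
    assume "i \<in> {1..<k}"
    then have "sporadic_task (\<tau> i)"
      using spor by simp
    then show "wcet (\<tau> i) - wcet (\<tau> i) * utilization (\<tau> i) \<le> wcet (\<tau> i)"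
      using utilization_nonneg by (simp add: sporadic_task_def)
  qed (use D in simp)
  \<comment> \<open>A maximum of two nonnegative numbers is at most their sum. The two summands are
    the missing terms at index \<open>k\<close> that complete both sums to
    \<open>{1..k}\<close>.\<close>
  moreover have "density (\<tau> k) \<le> wcet (\<tau> k) / ?D + utilization (\<tau> k)"
    using spk utilization_nonneg[OF spk] by (simp add: density_eq_max sporadic_task_def)
  moreover have "(\<Sum>i=1..k. wcet (\<tau> i) / ?D) \<le> load \<tau> k"
    by (rule sum_wcet_le_load) (use spor assms(4) D in auto)
  moreover have "(\<Sum>i=1..k. utilization (\<tau> i)) \<le> load \<tau> k"
    by (rule sum_utilization_le_load[OF spor])
  ultimately have "density (\<tau> k)
      + (\<Sum>i=1..<k. (wcet (\<tau> i) - wcet (\<tau> i) * utilization (\<tau> i)) / ?D + utilization (\<tau> i))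
      \<le> 2 * load \<tau> k"
    unfolding split by (simp add: sum.distrib)
  also have "\<dots> \<le> mu M \<tau> k"
  proof -
    have "(real M - 1) * ?\<delta> \<le> (real M - 1) * 1"
      using delta_max_bounds(2)[OF spor assms(2)] assms(1) by (intro mult_left_mono) auto
    then have "1 \<le> mu M \<tau> k"
      by (simp add: mu_def)
    then have "(1 :: real) \<le> of_int \<lceil>mu M \<tau> k\<rceil>"
      using le_of_int_ceiling order_trans by blast
    then have "0 \<le> (of_int \<lceil>mu M \<tau> k\<rceil> - 1) * ?\<delta>"
      using delta_max_bounds(1)[OF spor assms(2)] by simp
    with assms(5) show ?thesis
      by linarith
  qed
  also have "\<dots> \<le> real M - (real M - 1) * U_delta_max \<tau> k"
    unfolding mu_def using U_delta_max_le_delta_max[OF spor assms(2)] assms(1)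
    by (intro diff_left_mono mult_left_mono) auto
  finally show ?thesis .
qed

end
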